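(* Let $(X,\varsigma)$ and $(Y,\tau)$ be locally solid lattices and let $T:X\to Y$ be an order bounded disjointness preserving operator. Let $S:X\to Y$ be an operator whose modulus $|S|$ exists and satisfies $|S|\le|T|$. If $T$ is $KB$, then $S$ is $KB$; and if $T$ is $\sigma$-$KB$, then $S$ is $\sigma$-$KB$.
   Context: All vector spaces are real, operators are linear (not assumed continuous unless stated), vector topologies are Hausdorff, vector lattices are Archimedean. A locally solid lattice is a vector lattice with a linear topology having a base at zero of solid sets. The modulus of an operator $R$ between vector lattices is $|R|=\sup\{R,-R\}$ in the ordered space of operators; $A\le B$ means $B-A$ is positive. $T$ is disjointness preserving if $|x|\wedge|y|=0$ implies $|Tx|\wedge|Ty|=0$; the modulus of an order bounded disjointness preserving operator always exists and satisfies $|T||x|=|T|x||=|Tx|$ for all $x$. An operator $T$ from a locally solid lattice $(X,\varsigma)$ to a topological vector space $(Y,\tau)$ is called $KB$ (respectively $\sigma$-$KB$) if, for every $\varsigma$-bounded increasing net (respectively sequence) $(x_\alpha)$ in $X_+$, there exists a (not necessarily unique) $x\in X$ such that $Tx_\alpha\to Tx$ in $\tau$. *)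

theory Defs
  imports "HOL-Analysis.Analysis" "HOL-Library.Lattice_Algebras"
begin

section \<open>Vector lattices and locally solid lattices\<close>

class archimedean_vector_lattice = ordered_real_vector + lattice_ab_group_add_abs +
  assumes archimedean: "0 \<le> x \<Longrightarrow> (\<And>n::nat. real n *\<^sub>R x \<le> y) \<Longrightarrow> x = 0"

text \<open>The filter product \<open>nhds a \<times>\<^sub>F nhds x\<close> expresses joint continuity of scalar multiplication
  at \<open>(a, x)\<close>.\<close>

class topological_vector_space = real_vector + topological_ab_group_add + t2_space +
  assumes tendsto_scaleR_nhds:
    "((\<lambda>p. fst p *\<^sub>R snd p) \<longlongrightarrow> a *\<^sub>R x) (nhds a \<times>\<^sub>F nhds x)"

definition (in lattice_ab_group_add_abs) solid :: "'a set \<Rightarrow> bool" where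
  "solid V \<longleftrightarrow> (\<forall>x y. y \<in> V \<longrightarrow> \<bar>x\<bar> \<le> \<bar>y\<bar> \<longrightarrow> x \<in> V)"

text \<open>The members of the base of solid zero neighbourhoods are not required to be open.\<close>

class locally_solid_lattice = archimedean_vector_lattice + topological_vector_space +
  assumes solid_base:
    "open U \<Longrightarrow> 0 \<in> U \<Longrightarrow> \<exists>V. solid V \<and> (\<exists>W. open W \<and> 0 \<in> W \<and> W \<subseteq> V) \<and> V \<subseteq> U"

text \<open>The library predicate \<^const>\<open>bounded\<close> is metric, hence not available in this generality.\<close>

definition tvs_bounded :: "'a::topological_vector_space set \<Rightarrow> bool" where
  "tvs_bounded B \<longleftrightarrow> (\<forall>U. open U \<longrightarrow> 0 \<in> U \<longrightarrow> (\<exists>r>0. B \<subseteq> (*\<^sub>R) r ` U))"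

section \<open>Operators between vector lattices\<close>

definition positive_operator ::
    "('a::archimedean_vector_lattice \<Rightarrow> 'b::archimedean_vector_lattice) \<Rightarrow> bool" where
  "positive_operator T \<longleftrightarrow> linear T \<and> (\<forall>x\<ge>0. 0 \<le> T x)"

definition operator_le ::
    "('a::archimedean_vector_lattice \<Rightarrow> 'b::archimedean_vector_lattice) \<Rightarrow> ('a \<Rightarrow> 'b) \<Rightarrow> bool" where
  "operator_le A B \<longleftrightarrow> positive_operator (\<lambda>x. B x - A x)"

definition order_bounded_operator ::
    "('a::archimedean_vector_lattice \<Rightarrow> 'b::archimedean_vector_lattice) \<Rightarrow> bool" where
  "order_bounded_operator T \<longleftrightarrow> (\<forall>a b. \<exists>c d. T ` {a..b} \<subseteq> {c..d})"

definition disjointness_preserving ::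
    "('a::archimedean_vector_lattice \<Rightarrow> 'b::archimedean_vector_lattice) \<Rightarrow> bool" where
  "disjointness_preserving T \<longleftrightarrow> (\<forall>x y. inf \<bar>x\<bar> \<bar>y\<bar> = 0 \<longrightarrow> inf \<bar>T x\<bar> \<bar>T y\<bar> = 0)"

text \<open>\<open>R\<close> is the supremum of \<open>T\<close> and \<open>- T\<close> in the ordered space of all linear operators.\<close>

definition is_modulus ::
    "('a::archimedean_vector_lattice \<Rightarrow> 'b::archimedean_vector_lattice) \<Rightarrow> ('a \<Rightarrow> 'b) \<Rightarrow> bool" where
  "is_modulus T R \<longleftrightarrow>
     linear R \<and> operator_le T R \<and> operator_le (\<lambda>x. - T x) R \<and>
     (\<forall>Q. linear Q \<longrightarrow> operator_le T Q \<longrightarrow> operator_le (\<lambda>x. - T x) Q \<longrightarrow> operator_le R Q)"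

definition has_modulus ::
    "('a::archimedean_vector_lattice \<Rightarrow> 'b::archimedean_vector_lattice) \<Rightarrow> bool" where
  "has_modulus T \<longleftrightarrow> (\<exists>R. is_modulus T R)"

text \<open>Only meaningful for operators satisfying \<open>has_modulus\<close>.\<close>

definition modulus ::
    "('a::archimedean_vector_lattice \<Rightarrow> 'b::archimedean_vector_lattice) \<Rightarrow> ('a \<Rightarrow> 'b)" where
  "modulus T = (THE R. is_modulus T R)"

lemma is_modulus_unique:
  fixes T R R' :: "'a::archimedean_vector_lattice \<Rightarrow> 'b::archimedean_vector_lattice"
  assumes "is_modulus T R" "is_modulus T R'"
  shows "R = R'"
proof
  fix x :: 'a
  have lin: "linear R" "linear R'" and le: "operator_le R R'" "operator_le R' R"
    using assms by (auto simp: is_modulus_def)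
  have eq: "R u = R' u" if "0 \<le> u" for u
    using le that by (auto simp: operator_le_def positive_operator_def intro: order.antisym)
  have "x = pprt x - (- nprt x)" and "0 \<le> pprt x" "0 \<le> - nprt x"
    using prts[of x] by (simp_all del: neg_le_0_iff_le)
  then show "R x = R' x"
    using lin eq by (metis linear_diff)
qed

lemma modulus_eq: "is_modulus T R \<Longrightarrow> modulus T = R"
  unfolding modulus_def by (rule the_equality) (auto intro: is_modulus_unique)

section \<open>Nets\<close>

definition directed_on :: "'i set \<Rightarrow> 'i rel \<Rightarrow> bool" where
  "directed_on I r \<longleftrightarrow>
     I \<noteq> {} \<and> preorder_on I r \<and> (\<forall>i\<in>I. \<forall>j\<in>I. \<exists>k\<in>I. (i, k) \<in> r \<and> (j, k) \<in> r)"

text \<open>The filter of tails: \<open>(f \<longlongrightarrow> l) (net_filter I r)\<close> is convergence of the net \<open>f\<close> to \<open>l\<close>.\<close>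

definition net_filter :: "'i set \<Rightarrow> 'i rel \<Rightarrow> 'i filter" where
  "net_filter I r = (INF i\<in>I. principal {j \<in> I. (i, j) \<in> r})"

lemma eventually_net_filter:
  assumes "directed_on I r"
  shows "eventually P (net_filter I r) \<longleftrightarrow> (\<exists>i\<in>I. \<forall>j\<in>I. (i, j) \<in> r \<longrightarrow> P j)"
  unfolding net_filter_def
proof (subst eventually_INF_base)
  show "I \<noteq> {}" using assms by (simp add: directed_on_def)
next
  fix i j assume "i \<in> I" "j \<in> I"
  then obtain k where k: "k \<in> I" "(i, k) \<in> r" "(j, k) \<in> r"
    using assms unfolding directed_on_def by blast
  have "trans r" using assms by (simp add: directed_on_def preorder_on_def)
  with k show "\<exists>k\<in>I. principal {j \<in> I. (k, j) \<in> r}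
      \<le> inf (principal {j \<in> I. (i, j) \<in> r}) (principal {l \<in> I. (j, l) \<in> r})"
    by (auto intro!: bexI[of _ k] dest: transD)
qed (auto simp: eventually_principal)

text \<open>\<open>x\<close> is an increasing net in the positive cone, indexed by the directed set \<open>(I, r)\<close>,
  whose range is bounded.\<close>

definition bounded_increasing_net ::
    "'i set \<Rightarrow> 'i rel \<Rightarrow> ('i \<Rightarrow> 'a::locally_solid_lattice) \<Rightarrow> bool" where
  "bounded_increasing_net I r x \<longleftrightarrow>
     directed_on I r \<and> (\<forall>i\<in>I. 0 \<le> x i) \<and>
     (\<forall>i\<in>I. \<forall>j\<in>I. (i, j) \<in> r \<longrightarrow> x i \<le> x j) \<and> tvs_bounded (x ` I)"

section \<open>KB operators\<close>

text \<open>A definition cannot quantify over the type of the index set, so the index sets here are the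
  directed sets with elements in the domain type (and an arbitrary directed preorder). This is no
  restriction: \<open>KB_operator_net\<close> below gives the property for nets over arbitrary index types.\<close>

definition KB_operator ::
    "('a::locally_solid_lattice \<Rightarrow> 'b::topological_vector_space) \<Rightarrow> bool" where
  "KB_operator T \<longleftrightarrow>
     (\<forall>(I::'a set) r x. bounded_increasing_net I r x \<longrightarrow>
        (\<exists>l. ((\<lambda>i. T (x i)) \<longlongrightarrow> T l) (net_filter I r)))"

definition sigma_KB_operator ::
    "('a::locally_solid_lattice \<Rightarrow> 'b::topological_vector_space) \<Rightarrow> bool" where
  "sigma_KB_operator T \<longleftrightarrow>
     (\<forall>x::nat \<Rightarrow> 'a. incseq x \<longrightarrow> (\<forall>n. 0 \<le> x n) \<longrightarrow> tvs_bounded (range x) \<longrightarrow>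
        (\<exists>l. (\<lambda>n. T (x n)) \<longlonglongrightarrow> T l))"

lemma KB_operator_net:
  fixes I :: "'i set"
  assumes T: "KB_operator T" and x: "bounded_increasing_net I r x"
  shows "\<exists>l. ((\<lambda>i. T (x i)) \<longlongrightarrow> T l) (net_filter I r)"
proof -
  define D where "D = x ` I"
  define s where "s = {(u, v). u \<in> D \<and> v \<in> D \<and> u \<le> v}"
  have r: "directed_on I r" and mono: "\<And>i j. i \<in> I \<Longrightarrow> j \<in> I \<Longrightarrow> (i, j) \<in> r \<Longrightarrow> x i \<le> x j"
    using x by (auto simp: bounded_increasing_net_def)
  have ub: "\<exists>w\<in>D. (u, w) \<in> s \<and> (v, w) \<in> s" if "u \<in> D" "v \<in> D" for u v
  proof -
    from that obtain i j where ij: "i \<in> I" "j \<in> I" "u = x i" "v = x j" by (auto simp: D_def)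
    then obtain k where "k \<in> I" "(i, k) \<in> r" "(j, k) \<in> r"
      using r unfolding directed_on_def by blast
    with ij show ?thesis using mono by (intro bexI[of _ "x k"]) (auto simp: s_def D_def)
  qed
  have "preorder_on D s"
    by (auto simp: preorder_on_def refl_on_def trans_def s_def)
  moreover have "D \<noteq> {}" using r by (simp add: D_def directed_on_def)
  ultimately have s: "directed_on D s" using ub by (simp add: directed_on_def)
  have "bounded_increasing_net D s (\<lambda>u. u)"
    using x s by (auto simp: bounded_increasing_net_def s_def D_def)
  then obtain l where l: "((\<lambda>u. T u) \<longlongrightarrow> T l) (net_filter D s)"
    using T unfolding KB_operator_def by blast
  have "filterlim x (net_filter D s) (net_filter I r)"
    unfolding filterlim_iff
  proof (intro allI impI)
    fix P assume "eventually P (net_filter D s)"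
    then obtain u where "u \<in> D" "\<forall>v\<in>D. (u, v) \<in> s \<longrightarrow> P v"
      by (auto simp: eventually_net_filter[OF s])
    then obtain i where i: "i \<in> I" "\<forall>v\<in>D. (x i, v) \<in> s \<longrightarrow> P v"
      unfolding D_def by blast
    then have "\<forall>j\<in>I. (i, j) \<in> r \<longrightarrow> P (x j)"
      using mono by (auto simp: s_def D_def)
    with i show "eventually (\<lambda>j. P (x j)) (net_filter I r)"
      by (auto simp: eventually_net_filter[OF r])
  qed
  from filterlim_compose[OF l this] show ?thesis by blast
qed

end

theory Submission
  imports Defs
begin

text \<open>
  Once \<open>modulus T\<close> is known to exist and to satisfy \<open>modulus T \<bar>z\<bar> = \<bar>T z\<bar>\<close> (Meyer's theorem,
  here \<open>is_modulus_disjointness_preserving\<close> and \<open>modulus_abs_disjointness_preserving\<close>), domination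
  gives the pointwise estimate
  \<open>\<bar>S z\<bar> \<le> modulus S \<bar>z\<bar> \<le> modulus T \<bar>z\<bar> = \<bar>T z\<bar>\<close>.
  Applied to \<open>z = x\<^sub>i - l\<close> it shows, since the topology of the range has a base of solid zero
  neighbourhoods, that \<open>S x\<^sub>i\<close> converges to \<open>S l\<close> as soon as \<open>T x\<^sub>i\<close> converges to \<open>T l\<close>. The limit
  point \<open>l\<close> provided for \<open>T\<close> therefore serves for \<open>S\<close> as well, for nets and for sequences alike.

  The work lies in Meyer's theorem. A disjointness preserving \<open>T\<close> looks like a weighted composition
  operator \<open>(T x)(t) = w(t) x(\<phi>(t))\<close>; at each \<open>t\<close> the values of \<open>T\<close> on the positive cone all carry
  the sign of \<open>w(t)\<close>. The lattice form of this remark is \<open>inf_pprt_pprt_image_eq_0\<close>: for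
  \<open>x, y \<ge> 0\<close> the positive part of \<open>T x\<close> is disjoint from the negative part of \<open>T y\<close>. It makes
  \<open>x \<mapsto> \<bar>T x\<bar>\<close> additive on the positive cone, and the linear extension of this map is the modulus.

  For the sign lemma, suppose that \<open>T x > 0\<close> and \<open>T y < 0\<close> at \<open>t\<close>. As \<open>\<lambda>\<close> grows from \<open>0\<close>, exactly
  one of the images of the disjoint elements \<open>(x - \<lambda> y)\<^sup>+\<close> and \<open>(x - \<lambda> y)\<^sup>-\<close> is nonzero at \<open>t\<close>,
  at first that of the positive part. If there is a switch between \<open>\<lambda>\<close> and \<open>\<lambda> + \<delta>\<close>, then there
  \<open>T x - \<lambda> T y\<close> agrees with the image of \<open>(x - \<lambda> y)\<^sup>+ - (x - (\<lambda> + \<delta>) y)\<^sup>+\<close>, which lies in the order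
  interval from \<open>0\<close> to \<open>\<delta> y\<close>; so \<open>T x\<close>, which is at most \<open>T x - \<lambda> T y\<close>, is of size \<open>\<delta>\<close>
  there. If there is no switch up to \<open>\<lambda>\<close>, then \<open>T y\<close> agrees with the image of the infimum of \<open>y\<close> and \<open>x / \<lambda>\<close>, hence is of size \<open>1 / \<lambda>\<close>. Order
  boundedness makes both sizes uniform, and the Archimedean property finishes the argument.
\<close>

section \<open>Disjoint elements of a vector lattice\<close>

lemma inf_eq_0_mono:
  fixes a b :: "'a::lattice_ab_group_add"
  assumes "inf a b = 0" "0 \<le> a'" "a' \<le> a" "0 \<le> b'" "b' \<le> b"
  shows "inf a' b' = 0"
proof (rule order.antisym)
  show "inf a' b' \<le> 0"
    using inf_mono[OF assms(3,5)] unfolding assms(1) .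
qed (simp add: assms)

lemma inf_add_eq_0:
  fixes e a b :: "'a::lattice_ab_group_add"
  assumes "0 \<le> e" "0 \<le> a" "0 \<le> b" "inf e a = 0" "inf e b = 0"
  shows "inf e (a + b) = 0"
proof (rule order.antisym)
  let ?d = "inf e (a + b)"
  have "?d - b \<le> a" by (simp add: diff_le_eq)
  moreover have "?d - b \<le> ?d" using assms(3) by (simp only: diff_le_eq le_add_same_cancel1)
  then have "?d - b \<le> e" using inf_le1 by (rule order_trans)
  ultimately have "?d - b \<le> inf e a" by simp
  then have "?d \<le> b" using assms(4) by simp
  then have "?d \<le> inf e b" by simp
  then show "?d \<le> 0" using assms(5) by simp
qed (simp add: assms)

lemma eq_pprt_diff: "(a::'a::lattice_ab_group_add) = pprt a - pprt (- a)"
  unfolding pprt_neg diff_minus_eq_add by (rule prts)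

lemma pprt_eq_add: "pprt a = (a::'a::lattice_ab_group_add) + pprt (- a)"
proof -
  have "a + pprt (- a) = pprt a" unfolding eq_diff_eq[symmetric] by (rule eq_pprt_diff)
  then show ?thesis by (rule sym)
qed

lemma inf_pprt_pprt_minus:
  fixes a :: "'a::lattice_ab_group_add"
  shows "inf (pprt a) (pprt (- a)) = 0"
proof -
  have "inf (pprt a) (pprt (- a)) = inf (a + pprt (- a)) (0 + pprt (- a))"
    by (simp only: add_0_left flip: pprt_eq_add)
  also have "\<dots> = inf a 0 + pprt (- a)" by (simp only: add_inf_distrib_right)
  also have "\<dots> = 0" by (simp only: pprt_neg nprt_def add.right_inverse)
  finally show ?thesis .
qed

lemma abs_eq_pprt_add: "\<bar>a::'a::lattice_ab_group_add_abs\<bar> = pprt a + pprt (- a)"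
  by (simp add: abs_prts pprt_neg)

lemma pprt_minus_le_abs: "pprt (- a::'a::lattice_ab_group_add_abs) \<le> \<bar>a\<bar>"
  by (simp add: abs_eq_pprt_add)

lemma abs_diff_disjoint_nonneg:
  fixes a b :: "'a::lattice_ab_group_add_abs"
  assumes "inf a b = 0"
  shows "\<bar>a - b\<bar> = a + b"
proof -
  have "\<bar>a - b\<bar> = pprt (a - b) + pprt (- (a - b))" by (rule abs_eq_pprt_add)
  moreover have "pprt (a - b) = sup a b - b"
    using add_sup_distrib_right[of "a - b" 0 b] by (simp add: pprt_def eq_diff_eq)
  moreover have "pprt (- (a - b)) = sup a b - a"
    using add_sup_distrib_right[of "b - a" 0 a] by (simp add: pprt_def eq_diff_eq sup_commute)
  moreover have "sup a b = a + b" using add_eq_inf_sup[of a b] assms by simp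
  ultimately show ?thesis by simp
qed

lemma abs_diff_disjoint:
  fixes a b :: "'a::lattice_ab_group_add_abs"
  assumes "inf \<bar>a\<bar> \<bar>b\<bar> = 0"
  shows "\<bar>a - b\<bar> = \<bar>a\<bar> + \<bar>b\<bar>"
proof (rule order.antisym)
  have "\<bar>a\<bar> + \<bar>b\<bar> = \<bar>\<bar>a\<bar> - \<bar>b\<bar>\<bar>"
    using abs_diff_disjoint_nonneg[OF assms] by simp
  also have "\<dots> \<le> \<bar>a - b\<bar>" by (rule abs_triangle_ineq3)
  finally show "\<bar>a\<bar> + \<bar>b\<bar> \<le> \<bar>a - b\<bar>" .
qed (rule abs_triangle_ineq4)

text \<open>Elements with disjoint parts of opposite sign have the same sign wherever both are nonzero, so
  no cancellation occurs in their sum.\<close>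

lemma abs_add_same_sign:
  fixes a b :: "'a::lattice_ab_group_add_abs"
  assumes ab: "inf (pprt a) (pprt (- b)) = 0" and ba: "inf (pprt b) (pprt (- a)) = 0"
  shows "\<bar>a + b\<bar> = \<bar>a\<bar> + \<bar>b\<bar>"
proof -
  let ?p = "pprt a + pprt b" and ?n = "pprt (- a) + pprt (- b)"
  have "inf (pprt a) ?n = 0" "inf (pprt b) ?n = 0"
    using ab ba by (auto intro!: inf_add_eq_0 inf_pprt_pprt_minus)
  then have "inf ?n ?p = 0"
    by (intro inf_add_eq_0) (auto simp: inf_commute)
  then have "\<bar>?p - ?n\<bar> = ?p + ?n"
    by (intro abs_diff_disjoint_nonneg) (simp add: inf_commute)
  moreover have "a + b = ?p - ?n"
    by (metis add_diff_add eq_pprt_diff)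
  ultimately have "\<bar>a + b\<bar> = ?p + ?n" by simp
  then show ?thesis by (simp only: abs_eq_pprt_add ac_simps)
qed

lemma scaleR_sup_distrib:
  fixes a b :: "'a::archimedean_vector_lattice"
  assumes "0 \<le> r"
  shows "r *\<^sub>R sup a b = sup (r *\<^sub>R a) (r *\<^sub>R b)"
proof (cases "r = 0")
  case False
  with assms have r: "0 < r" by simp
  let ?s = "sup (r *\<^sub>R a) (r *\<^sub>R b)"
  have "a \<le> inverse r *\<^sub>R ?s" "b \<le> inverse r *\<^sub>R ?s"
    using scaleR_left_mono[of "r *\<^sub>R a" ?s "inverse r"] scaleR_left_mono[of "r *\<^sub>R b" ?s "inverse r"] r
    by simp_all
  then have "r *\<^sub>R sup a b \<le> r *\<^sub>R inverse r *\<^sub>R ?s"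
    using assms by (intro scaleR_left_mono) auto
  then have "r *\<^sub>R sup a b \<le> ?s" using r by simp
  moreover have "?s \<le> r *\<^sub>R sup a b"
    using assms by (simp add: scaleR_left_mono)
  ultimately show ?thesis by (rule order.antisym)
qed simp

lemma pprt_scaleR: "0 \<le> r \<Longrightarrow> pprt (r *\<^sub>R a) = r *\<^sub>R pprt (a::'a::archimedean_vector_lattice)"
  by (simp add: pprt_def scaleR_sup_distrib)

lemma abs_scaleR_nonneg: "0 \<le> r \<Longrightarrow> \<bar>r *\<^sub>R a\<bar> = r *\<^sub>R \<bar>a::'a::archimedean_vector_lattice\<bar>"
  by (simp add: abs_lattice scaleR_sup_distrib)

lemma inf_scaleR_eq_0:
  fixes e a :: "'a::archimedean_vector_lattice"
  assumes "0 \<le> r" "0 \<le> e" "0 \<le> a" "inf e a = 0"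
  shows "inf e (r *\<^sub>R a) = 0"
proof (rule order.antisym)
  let ?d = "inf e (r *\<^sub>R a)" and ?s = "max r 1"
  have d: "0 \<le> ?d" using assms by (simp add: scaleR_nonneg_nonneg)
  have "inverse ?s *\<^sub>R ?d \<le> 1 *\<^sub>R ?d"
    using d by (intro scaleR_right_mono) (auto simp: inverse_le_1_iff)
  then have "inverse ?s *\<^sub>R ?d \<le> e" by (simp add: inf.coboundedI1)
  moreover have "inverse ?s *\<^sub>R ?d \<le> inverse ?s *\<^sub>R ?s *\<^sub>R a"
  proof (rule scaleR_left_mono)
    have "?d \<le> r *\<^sub>R a" by simp
    also have "\<dots> \<le> ?s *\<^sub>R a" using assms by (intro scaleR_right_mono) auto
    finally show "?d \<le> ?s *\<^sub>R a" .
  qed simp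
  then have "inverse ?s *\<^sub>R ?d \<le> a" by (simp add: max_def split: if_splits)
  ultimately have "inverse ?s *\<^sub>R ?d \<le> inf e a" by simp
  then have "inverse ?s *\<^sub>R ?d \<le> 0" using assms by simp
  then have "?s *\<^sub>R inverse ?s *\<^sub>R ?d \<le> ?s *\<^sub>R 0"
    by (intro scaleR_left_mono) auto
  then show "?d \<le> 0" by (simp add: max_def split: if_splits)
qed (use assms in \<open>simp add: scaleR_nonneg_nonneg\<close>)

section \<open>Signs of the values of a disjointness preserving operator\<close>

lemma order_bounded_on_interval:
  fixes T :: "'a::archimedean_vector_lattice \<Rightarrow> 'b::archimedean_vector_lattice"
  assumes "order_bounded_operator T"
  obtains u where "0 \<le> u" "\<And>z. a \<le> z \<Longrightarrow> z \<le> b \<Longrightarrow> \<bar>T z\<bar> \<le> u"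
proof -
  obtain c d where cd: "T ` {a..b} \<subseteq> {c..d}"
    using assms unfolding order_bounded_operator_def by blast
  show thesis
  proof (rule that[of "\<bar>c\<bar> + \<bar>d\<bar>"])
    fix z assume "a \<le> z" "z \<le> b"
    then have "T z \<in> T ` {a..b}" by simp
    with cd have "T z \<in> {c..d}" by (rule subsetD)
    then have z: "c \<le> T z" "T z \<le> d" by simp_all
    show "\<bar>T z\<bar> \<le> \<bar>c\<bar> + \<bar>d\<bar>"
    proof (rule abs_leI)
      have "T z \<le> \<bar>d\<bar>" using z(2) abs_ge_self by (rule order_trans)
      then show "T z \<le> \<bar>c\<bar> + \<bar>d\<bar>" by (simp add: add_increasing)
      have "- T z \<le> - c" using z(1) by simp
      then have "- T z \<le> \<bar>c\<bar>" using abs_ge_minus_self by (rule order_trans)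
      then show "- T z \<le> \<bar>c\<bar> + \<bar>d\<bar>" by (simp add: add_increasing2)
    qed
  qed simp
qed

text \<open>Where \<open>X > 0\<close> and \<open>Y < 0\<close>, the element \<open>X\<close> is at most \<open>X - \<lambda> Y\<close>. Hence \<open>e\<close>, which lives where
  \<open>X\<close> and \<open>- Y\<close> both exceed \<open>d\<close>, must meet any \<open>s\<close> that accounts for the excess of \<open>\<bar>X - \<lambda> Y\<bar>\<close>
  over \<open>d\<close>, unless it vanishes.\<close>

lemma eq_0_if_disjoint_excess:
  fixes X Y d e s :: "'a::archimedean_vector_lattice"
  assumes "0 \<le> l" "0 \<le> d" "0 \<le> s" "0 \<le> e"
    and e: "e \<le> pprt (inf (pprt X) (pprt (- Y)) - d)"
    and bound: "\<bar>X - l *\<^sub>R Y\<bar> \<le> d + s" and disj: "inf e s = 0"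
  shows "e = 0"
proof -
  let ?p = "inf (pprt X) (pprt (- Y))"
  let ?t = "pprt (- X) + l *\<^sub>R pprt Y"
  have t0: "0 \<le> l *\<^sub>R pprt Y" using assms by (simp add: scaleR_nonneg_nonneg)
  have "pprt (?p - d) \<le> pprt ?p" using assms(2)
    by (intro pprt_mono) (simp only: diff_le_eq le_add_same_cancel1)
  then have ep: "e \<le> ?p" using e by (auto intro: order_trans)
  have "inf e (pprt (- X)) = 0"
    by (rule inf_eq_0_mono[OF inf_pprt_pprt_minus[of X]]) (use ep assms(4) in auto)
  moreover have "inf e (pprt Y) = 0"
    by (rule inf_eq_0_mono[OF inf_pprt_pprt_minus[of "- Y"]]) (use ep assms(4) in auto)
  ultimately have "inf e (s + ?t) = 0"
    using assms t0 by (intro inf_add_eq_0 inf_scaleR_eq_0) auto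
  moreover have "e \<le> s + ?t"
  proof -
    have "?p \<le> pprt X" by simp
    also have "\<dots> = (X - l *\<^sub>R Y) + ?t - l *\<^sub>R pprt (- Y)"
    proof -
      have X: "pprt X = X + pprt (- X)"
        by (rule pprt_eq_add)
      have "l *\<^sub>R Y = l *\<^sub>R pprt Y - l *\<^sub>R pprt (- Y)"
        by (metis eq_pprt_diff scaleR_diff_right)
      then have Y: "l *\<^sub>R pprt Y = l *\<^sub>R Y + l *\<^sub>R pprt (- Y)"
        by (metis diff_eq_eq)
      show ?thesis unfolding X Y by (simp add: algebra_simps)
    qed
    also have "\<dots> \<le> (X - l *\<^sub>R Y) + ?t"
      using assms(1) by (simp add: scaleR_nonneg_nonneg)
    also have "\<dots> \<le> (d + s) + ?t"
      using bound abs_ge_self order_trans by (intro add_right_mono) blast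
    finally have "?p - d \<le> s + ?t" by (simp add: algebra_simps)
    moreover have "0 \<le> s + ?t" using assms(3) t0 by simp
    ultimately have "pprt (?p - d) \<le> s + ?t" by (simp add: pprt_def)
    with e show ?thesis by (rule order_trans)
  qed
  ultimately show "e = 0" by (simp add: inf_absorb1)
qed

text \<open>The sign lemma. The scale \<open>k / m\<close> runs through \<open>0, 1 / m, \<dots>, m\<close>; the steps \<open>1 / m\<close> bound the
  error made at a switch, the end value \<open>m\<close> the error made when no switch occurs. The part \<open>q\<close> of
  \<open>p\<close> that is too large for a switch stays disjoint from all the images of the negative parts, and
  at the end it is of size \<open>1 / m\<close> itself.\<close>

lemma inf_pprt_pprt_image_eq_0:
  fixes T :: "'a::archimedean_vector_lattice \<Rightarrow> 'b::archimedean_vector_lattice"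
  assumes T: "linear T" "order_bounded_operator T" "disjointness_preserving T"
    and x: "0 \<le> x" and y: "0 \<le> y"
  shows "inf (pprt (T x)) (pprt (- T y)) = 0"
proof -
  define p where "p = inf (pprt (T x)) (pprt (- T y))"
  have p0: "0 \<le> p" by (simp add: p_def)
  obtain u where u0: "0 \<le> u" and u: "\<And>z. 0 \<le> z \<Longrightarrow> z \<le> x + y \<Longrightarrow> \<bar>T z\<bar> \<le> u"
    using order_bounded_on_interval[OF T(2)] by metis
  have small: "real m *\<^sub>R p \<le> u + u" for m :: nat
  proof (cases "m = 0")
    case True
    then show ?thesis using u0 by simp
  next
    case False
    then have m: "0 < real m" by simp
    define d where "d = (1 / real m) *\<^sub>R u"
    define q where "q = pprt (p - d)"
    define a where "a k = x - (real k / real m) *\<^sub>R y" for k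
    define P where "P k = \<bar>T (pprt (a k))\<bar>" for k
    define N where "N k = \<bar>T (pprt (- a k))\<bar>" for k
    have nn: "0 \<le> d" "0 \<le> q" "\<And>k. 0 \<le> P k" "\<And>k. 0 \<le> N k"
      using u0 m by (auto simp: d_def q_def P_def N_def scaleR_nonneg_nonneg)
    have PN: "inf (P k) (N k) = 0" for k
      using T(3) inf_pprt_pprt_minus[of "a k"]
      unfolding disjointness_preserving_def P_def N_def by simp
    have Ta: "T x - (real k / real m) *\<^sub>R T y = T (a k)" for k
      by (simp add: a_def linear_diff[OF T(1)] linear_scale[OF T(1)])
    have Tsplit: "T (a k) = T (pprt (a k)) - T (pprt (- a k))" for k
      using eq_pprt_diff[of "a k"] linear_diff[OF T(1)] by metis
    have le_PN: "\<bar>T x - (real k / real m) *\<^sub>R T y\<bar> \<le> d + (P k + N k)" for k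
    proof -
      have "\<bar>T (a k)\<bar> \<le> P k + N k"
        unfolding Tsplit P_def N_def by (rule abs_triangle_ineq4)
      then show ?thesis unfolding Ta using nn(1) by (simp add: add_increasing)
    qed
    \<comment> \<open>Disregarding the images of \<open>(a (k + 1))\<^sup>+\<close> and \<open>(a k)\<^sup>-\<close>, which both vanish at a switch, \<open>T (a k)\<close>
      is \<open>T c\<close> for an element \<open>c\<close> between \<open>0\<close> and \<open>y / m\<close>.\<close>
    have switch: "\<bar>T x - (real k / real m) *\<^sub>R T y\<bar> \<le> d + (P (Suc k) + N k)" for k
    proof -
      define c where "c = pprt (a k) - pprt (a (Suc k))"
      have step: "a k = a (Suc k) + (1 / real m) *\<^sub>R y"
        by (simp add: a_def add_divide_distrib scaleR_left_distrib)
      have dy: "0 \<le> (1 / real m) *\<^sub>R y" using y by (simp add: scaleR_nonneg_nonneg)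
      have "a (Suc k) \<le> a k" using dy by (simp add: step)
      then have c0: "0 \<le> c" by (simp add: c_def)
      have "pprt (a k) \<le> pprt (a (Suc k)) + (1 / real m) *\<^sub>R y"
        using dy unfolding step pprt_def by (intro le_supI add_right_mono add_nonneg_nonneg) auto
      then have "c \<le> (1 / real m) *\<^sub>R y" by (simp add: c_def diff_le_eq add.commute)
      then have "real m *\<^sub>R c \<le> real m *\<^sub>R (1 / real m) *\<^sub>R y"
        by (rule scaleR_left_mono) simp
      then have "real m *\<^sub>R c \<le> y" using m by simp
      then have "\<bar>T (real m *\<^sub>R c)\<bar> \<le> u"
        using c0 x by (intro u) (auto simp: scaleR_nonneg_nonneg intro: add_increasing)
      then have "(1 / real m) *\<^sub>R (real m *\<^sub>R \<bar>T c\<bar>) \<le> d"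
        unfolding d_def by (intro scaleR_left_mono) (auto simp: linear_scale[OF T(1)] abs_scaleR_nonneg)
      then have Tc: "\<bar>T c\<bar> \<le> d" using m by simp
      have "T (a k) = T c + (T (pprt (a (Suc k))) - T (pprt (- a k)))"
        by (simp add: Tsplit[of k] c_def linear_diff[OF T(1)])
      also have "\<bar>\<dots>\<bar> \<le> \<bar>T c\<bar> + \<bar>T (pprt (a (Suc k))) - T (pprt (- a k))\<bar>"
        by (rule abs_triangle_ineq)
      also have "\<dots> \<le> d + (P (Suc k) + N k)"
        unfolding P_def N_def by (intro add_mono Tc abs_triangle_ineq4)
      finally show ?thesis unfolding Ta .
    qed
    \<comment> \<open>A part \<open>e\<close> of \<open>q\<close> that meets \<open>N (k + 1)\<close> but not \<open>N k\<close> would have to meet \<open>P k\<close>: a switch,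
      which \<open>q\<close> is too large for.\<close>
    have qN: "inf q (N k) = 0" for k
    proof (induction k)
      case 0
      have "N 0 = 0" using x by (simp add: N_def a_def linear_0[OF T(1)])
      then show ?case using nn by (simp add: inf_absorb2)
    next
      case (Suc k)
      define e where "e = inf q (N (Suc k))"
      have e0: "0 \<le> e" and eq: "e \<le> q" and eN: "e \<le> N (Suc k)"
        using nn by (auto simp: e_def)
      have "inf (inf e (P k)) (P (Suc k)) = 0"
        by (rule inf_eq_0_mono[OF PN[of "Suc k", unfolded inf_commute[of "P _"]]])
          (use e0 eN nn in \<open>auto intro: le_infI1\<close>)
      moreover have "inf (inf e (P k)) (N k) = 0"
        by (rule inf_eq_0_mono[OF PN[of k]]) (use e0 nn in auto)
      ultimately have "inf (inf e (P k)) (P (Suc k) + N k) = 0"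
        using e0 nn by (intro inf_add_eq_0) auto
      then have "inf e (P k) = 0"
        using switch[of k] e0 nn eq
        by (intro eq_0_if_disjoint_excess[where l = "real k / real m" and d = d and X = "T x"
              and Y = "T y" and s = "P (Suc k) + N k" and e = "inf e (P k)"])
          (simp_all add: q_def p_def le_infI1)
      moreover have "inf e (N k) = 0"
        by (rule inf_eq_0_mono[OF Suc.IH]) (use e0 nn eq in auto)
      ultimately have "inf e (P k + N k) = 0"
        using e0 nn by (intro inf_add_eq_0) auto
      then have "e = 0"
        using le_PN[of k] e0 nn eq
        by (intro eq_0_if_disjoint_excess[where l = "real k / real m" and d = d and X = "T x"
              and Y = "T y" and s = "P k + N k" and e = e])
          (simp_all add: q_def p_def)
      then show ?case by (simp add: e_def)
    qed
    \<comment> \<open>At the scale \<open>m\<close> no switch has occurred on \<open>q\<close>: up to \<open>M\<close>, which \<open>q\<close> does not meet, \<open>m T y\<close> is the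
      image of the infimum \<open>v\<close> of \<open>m y\<close> and \<open>x\<close>.\<close>
    define M where "M = N (m * m)"
    have aM: "a (m * m) = x - real m *\<^sub>R y" using m by (simp add: a_def)
    have qp: "q \<le> p"
      unfolding q_def using p0 nn(1) by (simp add: pprt_def)
    have mq0: "0 \<le> real m *\<^sub>R q" using nn by (simp add: scaleR_nonneg_nonneg)
    have le: "real m *\<^sub>R q \<le> u + M"
    proof -
      define v where "v = real m *\<^sub>R y - pprt (real m *\<^sub>R y - x)"
      have "pprt (real m *\<^sub>R y - x) \<le> real m *\<^sub>R y"
        using x y by (simp add: pprt_def scaleR_nonneg_nonneg)
      then have "0 \<le> v" by (simp add: v_def)
      moreover have "real m *\<^sub>R y - x \<le> pprt (real m *\<^sub>R y - x)" by (simp add: pprt_def)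
      then have "v \<le> x" by (simp add: v_def algebra_simps)
      ultimately have "\<bar>T v\<bar> \<le> u" using y by (intro u) (auto intro: add_increasing2)
      moreover have "real m *\<^sub>R T y = T v + T (pprt (real m *\<^sub>R y - x))"
        by (simp add: v_def linear_diff[OF T(1)] linear_scale[OF T(1)])
      then have "\<bar>real m *\<^sub>R T y\<bar> \<le> \<bar>T v\<bar> + M"
        by (simp add: M_def N_def aM abs_triangle_ineq)
      ultimately have "real m *\<^sub>R \<bar>T y\<bar> \<le> u + M"
        by (simp add: abs_scaleR_nonneg) (meson add_right_mono order_trans)
      moreover have "q \<le> \<bar>T y\<bar>"
        using qp pprt_minus_le_abs[of "T y"] by (auto simp: p_def intro: order_trans)
      then have "real m *\<^sub>R q \<le> real m *\<^sub>R \<bar>T y\<bar>" by (rule scaleR_left_mono) simp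
      ultimately show ?thesis by (rule order_trans[rotated])
    qed
    have "inf M (real m *\<^sub>R q) = 0"
      using qN[of "m * m"] nn by (intro inf_scaleR_eq_0) (auto simp: M_def inf_commute)
    moreover have "pprt (real m *\<^sub>R q - u) \<le> inf M (real m *\<^sub>R q)"
      using le mq0 u0 nn(4) by (simp add: pprt_def M_def algebra_simps)
    ultimately have "pprt (real m *\<^sub>R q - u) \<le> 0" by simp
    then have mq: "real m *\<^sub>R q \<le> u" by (simp add: pprt_def)
    have "p - d \<le> q" by (simp add: q_def pprt_def)
    then have "real m *\<^sub>R p \<le> real m *\<^sub>R (q + d)"
      by (intro scaleR_left_mono) (auto simp: algebra_simps)
    also have "\<dots> = real m *\<^sub>R q + u" using m by (simp add: d_def scaleR_right_distrib)
    also have "\<dots> \<le> u + u" using mq by simp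
    finally show ?thesis .
  qed
  have "p = 0" using p0 small by (rule archimedean)
  then show ?thesis by (simp add: p_def)
qed

section \<open>The modulus of a disjointness preserving operator\<close>

lemma abs_image_add_disjointness_preserving:
  fixes T :: "'a::archimedean_vector_lattice \<Rightarrow> 'b::archimedean_vector_lattice"
  assumes T: "linear T" "order_bounded_operator T" "disjointness_preserving T"
    and "0 \<le> x" "0 \<le> y"
  shows "\<bar>T (x + y)\<bar> = \<bar>T x\<bar> + \<bar>T y\<bar>"
  unfolding linear_add[OF T(1)]
  by (intro abs_add_same_sign inf_pprt_pprt_image_eq_0 assms)

text \<open>Additivity on the cone makes \<open>f a - f b\<close> depend only on \<open>a - b\<close>; this lets the extension be
  computed from \<open>x\<^sup>+ + y\<^sup>+\<close> and \<open>x\<^sup>- + y\<^sup>-\<close> instead of the parts of \<open>x + y\<close>.\<close>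

lemma linear_extension_from_cone:
  fixes f :: "'a::archimedean_vector_lattice \<Rightarrow> 'b::archimedean_vector_lattice"
  assumes add: "\<And>x y. 0 \<le> x \<Longrightarrow> 0 \<le> y \<Longrightarrow> f (x + y) = f x + f y"
    and scale: "\<And>r x. 0 \<le> r \<Longrightarrow> 0 \<le> x \<Longrightarrow> f (r *\<^sub>R x) = r *\<^sub>R f x"
  shows "linear (\<lambda>x. f (pprt x) - f (pprt (- x)))" (is "linear ?R")
proof (rule linearI)
  fix x y :: 'a
  have "pprt (x + y) + (pprt (- x) + pprt (- y)) = pprt (- (x + y)) + (pprt x + pprt y)"
  proof -
    have "pprt (x + y) - pprt (- (x + y)) = (pprt x - pprt (- x)) + (pprt y - pprt (- y))"
      by (simp only: eq_pprt_diff[symmetric])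
    then show ?thesis by (simp add: algebra_simps)
  qed
  then have "f (pprt (x + y) + (pprt (- x) + pprt (- y))) = f (pprt (- (x + y)) + (pprt x + pprt y))"
    by (rule arg_cong)
  then have "f (pprt (x + y)) + (f (pprt (- x)) + f (pprt (- y)))
      = f (pprt (- (x + y))) + (f (pprt x) + f (pprt y))"
    by (simp only: add zero_le_pprt add_nonneg_nonneg)
  then show "?R (x + y) = ?R x + ?R y" by (simp add: algebra_simps)
next
  fix r and x :: 'a
  have pos: "?R (s *\<^sub>R z) = s *\<^sub>R ?R z" if "0 \<le> s" for s and z :: 'a
    using that by (simp add: pprt_scaleR scale scaleR_diff_right flip: scaleR_minus_right)
  show "?R (r *\<^sub>R x) = r *\<^sub>R ?R x"
  proof (cases "0 \<le> r")
    case False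
    then have "?R ((- r) *\<^sub>R (- x)) = (- r) *\<^sub>R ?R (- x)" by (intro pos) simp
    then show ?thesis by (simp add: algebra_simps)
  qed (rule pos)
qed

lemma is_modulus_disjointness_preserving:
  fixes T :: "'a::archimedean_vector_lattice \<Rightarrow> 'b::archimedean_vector_lattice"
  assumes T: "linear T" "order_bounded_operator T" "disjointness_preserving T"
  shows "is_modulus T (\<lambda>x. \<bar>T (pprt x)\<bar> - \<bar>T (pprt (- x))\<bar>)" (is "is_modulus T ?R")
proof -
  have R: "linear ?R"
    using T by (intro linear_extension_from_cone)
      (auto simp: abs_image_add_disjointness_preserving linear_scale abs_scaleR_nonneg)
  have Rpos: "?R x = \<bar>T x\<bar>" if "0 \<le> x" for x
    using that by (simp add: linear_0[OF T(1)])
  show ?thesis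
    unfolding is_modulus_def operator_le_def positive_operator_def
  proof (intro conjI allI impI)
    show "linear ?R" by (rule R)
    show "linear (\<lambda>x. ?R x - T x)" using R T(1) by (rule linear_compose_sub)
    show "linear (\<lambda>x. ?R x - - T x)"
      using linear_compose_sub[OF R linear_compose_neg[OF T(1)]] .
    fix x :: 'a assume "0 \<le> x"
    then have "?R x = \<bar>T x\<bar>" by (rule Rpos)
    then show "0 \<le> ?R x - T x" "0 \<le> ?R x - - T x"
      by (metis abs_ge_self abs_ge_minus_self diff_ge_0_iff_ge)+
  next
    fix Q assume Q: "linear Q" "linear (\<lambda>x. Q x - T x) \<and> (\<forall>x\<ge>0. 0 \<le> Q x - T x)"
      "linear (\<lambda>x. Q x - - T x) \<and> (\<forall>x\<ge>0. 0 \<le> Q x - - T x)"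
    show "linear (\<lambda>x. Q x - ?R x)" using Q(1) R by (rule linear_compose_sub)
    fix x :: 'a assume x: "0 \<le> x"
    then have "T x \<le> Q x" "- T x \<le> Q x" using Q by (metis diff_ge_0_iff_ge)+
    then show "0 \<le> Q x - ?R x" unfolding Rpos[OF x] by (simp add: abs_leI)
  qed
qed

text \<open>Both sides equal \<open>\<bar>T z\<^sup>+\<bar> + \<bar>T z\<^sup>-\<bar>\<close>: the left one by additivity, the right one because the
  images of \<open>z\<^sup>+\<close> and \<open>z\<^sup>-\<close> are disjoint.\<close>

lemma modulus_abs_disjointness_preserving:
  fixes T :: "'a::archimedean_vector_lattice \<Rightarrow> 'b::archimedean_vector_lattice"
  assumes T: "linear T" "order_bounded_operator T" "disjointness_preserving T"
  shows "modulus T \<bar>z\<bar> = \<bar>T z\<bar>"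
proof -
  have "modulus T \<bar>z\<bar> = \<bar>T \<bar>z\<bar>\<bar>"
    by (simp add: modulus_eq[OF is_modulus_disjointness_preserving[OF T]] linear_0[OF T(1)])
  also have "\<dots> = \<bar>T (pprt z)\<bar> + \<bar>T (pprt (- z))\<bar>"
    unfolding abs_eq_pprt_add[of z] by (rule abs_image_add_disjointness_preserving[OF T]) simp_all
  also have "\<dots> = \<bar>T (pprt z) - T (pprt (- z))\<bar>"
    using T(3) inf_pprt_pprt_minus[of z]
    by (intro abs_diff_disjoint[symmetric]) (simp add: disjointness_preserving_def)
  also have "\<dots> = \<bar>T z\<bar>"
    by (metis linear_diff[OF T(1)] eq_pprt_diff)
  finally show ?thesis .
qed

section \<open>Domination\<close>

lemma is_modulus_modulus: "has_modulus S \<Longrightarrow> is_modulus S (modulus S)"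
  unfolding has_modulus_def using modulus_eq by metis

lemma abs_image_le_modulus_abs:
  assumes S: "linear S" and mod: "has_modulus S"
  shows "\<bar>S z\<bar> \<le> modulus S \<bar>z\<bar>"
proof -
  let ?R = "modulus S"
  have R: "linear ?R" and "operator_le S ?R" "operator_le (\<lambda>x. - S x) ?R"
    using is_modulus_modulus[OF mod] by (simp_all add: is_modulus_def)
  then have ge: "S x \<le> ?R x" "- S x \<le> ?R x" if "0 \<le> x" for x
    unfolding operator_le_def positive_operator_def using that by (metis diff_ge_0_iff_ge)+
  have pos: "\<bar>S x\<bar> \<le> ?R x" if "0 \<le> x" for x using ge that by (simp add: abs_leI)
  have "\<bar>S z\<bar> = \<bar>S (pprt z) - S (pprt (- z))\<bar>"
    by (metis linear_diff[OF S] eq_pprt_diff)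
  also have "\<dots> \<le> \<bar>S (pprt z)\<bar> + \<bar>S (pprt (- z))\<bar>" by (rule abs_triangle_ineq4)
  also have "\<dots> \<le> ?R (pprt z) + ?R (pprt (- z))" by (intro add_mono pos) simp_all
  also have "\<dots> = ?R \<bar>z\<bar>" by (simp add: abs_eq_pprt_add linear_add[OF R])
  finally show ?thesis .
qed

lemma tendsto_0_dominated_locally_solid:
  fixes f g :: "'i \<Rightarrow> 'b::locally_solid_lattice"
  assumes dom: "\<And>i. \<bar>f i\<bar> \<le> \<bar>g i\<bar>" and g: "(g \<longlongrightarrow> 0) F"
  shows "(f \<longlongrightarrow> 0) F"
proof (rule topological_tendstoI)
  fix U :: "'b set" assume "open U" "0 \<in> U"
  then obtain V W where V: "solid V" "V \<subseteq> U" and W: "open W" "0 \<in> W" "W \<subseteq> V"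
    using solid_base by meson
  have "\<forall>\<^sub>F i in F. g i \<in> W" using g W(1,2) by (rule topological_tendstoD)
  then show "\<forall>\<^sub>F i in F. f i \<in> U"
    by (rule eventually_mono) (metis V W(3) dom solid_def subsetD)
qed

lemma tendsto_image_dominated:
  fixes S T :: "'a::real_vector \<Rightarrow> 'b::locally_solid_lattice"
  assumes S: "linear S" and T: "linear T" and dom: "\<And>z. \<bar>S z\<bar> \<le> \<bar>T z\<bar>"
    and lim: "((\<lambda>i. T (x i)) \<longlongrightarrow> T l) F"
  shows "((\<lambda>i. S (x i)) \<longlongrightarrow> S l) F"
proof -
  have "((\<lambda>i. T (x i) - T l) \<longlongrightarrow> 0) F"
    using tendsto_diff[OF lim tendsto_const[of "T l"]] by simp
  then have "((\<lambda>i. S (x i) - S l) \<longlongrightarrow> 0) F"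
    by (rule tendsto_0_dominated_locally_solid[rotated])
      (use dom in \<open>simp flip: linear_diff[OF S] linear_diff[OF T]\<close>)
  from tendsto_add[OF this tendsto_const[of "S l"]] show ?thesis by simp
qed

theorem theorem2p5:
  fixes T S :: "'a::locally_solid_lattice \<Rightarrow> 'b::locally_solid_lattice"
  assumes "linear T" and "order_bounded_operator T" and "disjointness_preserving T"
    and "linear S" and "has_modulus S" and "operator_le (modulus S) (modulus T)"
  shows "(KB_operator T \<longrightarrow> KB_operator S) \<and> (sigma_KB_operator T \<longrightarrow> sigma_KB_operator S)"
proof -
  have dom: "\<bar>S z\<bar> \<le> \<bar>T z\<bar>" for z
  proof -
    have "\<bar>S z\<bar> \<le> modulus S \<bar>z\<bar>" using assms(4,5) by (rule abs_image_le_modulus_abs)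
    also have "\<dots> \<le> modulus T \<bar>z\<bar>"
      using assms(6) by (simp add: operator_le_def positive_operator_def)
    also have "\<dots> = \<bar>T z\<bar>" using assms(1-3) by (rule modulus_abs_disjointness_preserving)
    finally show ?thesis .
  qed
  note lim = tendsto_image_dominated[OF assms(4,1) dom]
  show ?thesis
  proof (intro conjI impI)
    assume T: "KB_operator T"
    show "KB_operator S"
      unfolding KB_operator_def
    proof (intro allI impI)
      fix I :: "'a set" and r and x :: "'a \<Rightarrow> 'a"
      assume "bounded_increasing_net I r x"
      with T obtain l where "((\<lambda>i. T (x i)) \<longlongrightarrow> T l) (net_filter I r)"
        unfolding KB_operator_def by blast
      then show "\<exists>l. ((\<lambda>i. S (x i)) \<longlongrightarrow> S l) (net_filter I r)"
        by (intro exI) (rule lim)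
    qed
  next
    assume T: "sigma_KB_operator T"
    show "sigma_KB_operator S"
      unfolding sigma_KB_operator_def
    proof (intro allI impI)
      fix x :: "nat \<Rightarrow> 'a"
      assume "incseq x" "\<forall>n. 0 \<le> x n" "tvs_bounded (range x)"
      with T obtain l where "(\<lambda>n. T (x n)) \<longlonglongrightarrow> T l"
        unfolding sigma_KB_operator_def by blast
      then show "\<exists>l. (\<lambda>n. S (x n)) \<longlonglongrightarrow> S l"
        by (intro exI) (rule lim)
    qed
  qed
qed

end
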